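(* For every rank-three matroid $M$ on a finite ground set $E$ and every three-coloring $E=E_1\sqcup E_2\sqcup E_3$, $$b_{111}^3\,b_{300}\,b_{030}\,b_{003}\le b_{210}\,b_{201}\,b_{120}\,b_{021}\,b_{102}\,b_{012}.$$ The constant $1$ is sharp: for no real $C<1$ does $b_{111}^3b_{300}b_{030}b_{003}\le C\,b_{210}b_{201}b_{120}b_{021}b_{102}b_{012}$ hold for all rank-three matroids and all three-colorings.
   Context: For a rank-three matroid $M$ with set of bases $\mathcal B(M)$ and a partition $E=E_1\sqcup E_2\sqcup E_3$ of its ground set, and $a+b+c=3$ with $a,b,c\in\mathbb Z_{\ge0}$, $$b_{abc}=\#\{B\in\mathcal B(M):|B\cap E_1|=a,\ |B\cap E_2|=b,\ |B\cap E_3|=c\}.$$ *)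

theory Defs
  imports Complex_Main
begin

locale matroid =
  fixes E :: "'a set" and indep :: "'a set \<Rightarrow> bool"
  assumes finite_ground: "finite E"
    and indep_subset_ground: "indep X \<Longrightarrow> X \<subseteq> E"
    and indep_empty: "indep {}"
    and indep_subset: "indep Y \<Longrightarrow> X \<subseteq> Y \<Longrightarrow> indep X"
    and indep_augment:
      "indep X \<Longrightarrow> indep Y \<Longrightarrow> card X < card Y \<Longrightarrow> \<exists>y \<in> Y - X. indep (insert y X)"

definition matroid_bases :: "('a set \<Rightarrow> bool) \<Rightarrow> 'a set set" where
  "matroid_bases indep = {B. indep B \<and> (\<forall>X. indep X \<longrightarrow> B \<subseteq> X \<longrightarrow> X = B)}"

definition matroid_rank :: "('a set \<Rightarrow> bool) \<Rightarrow> nat" where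
  "matroid_rank indep = Max (card ` {X. indep X})"

text \<open>Colour classes are allowed to be empty.\<close>

definition three_coloring :: "'a set \<Rightarrow> 'a set \<Rightarrow> 'a set \<Rightarrow> 'a set \<Rightarrow> bool" where
  "three_coloring E E1 E2 E3 \<longleftrightarrow>
     E = E1 \<union> E2 \<union> E3 \<and> E1 \<inter> E2 = {} \<and> E1 \<inter> E3 = {} \<and> E2 \<inter> E3 = {}"

definition base_count ::
  "('a set \<Rightarrow> bool) \<Rightarrow> 'a set \<Rightarrow> 'a set \<Rightarrow> 'a set \<Rightarrow> nat \<Rightarrow> nat \<Rightarrow> nat \<Rightarrow> nat" where
  "base_count indep E1 E2 E3 a b c =
     card {B \<in> matroid_bases indep. card (B \<inter> E1) = a \<and> card (B \<inter> E2) = b \<and> card (B \<inter> E3) = c}"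

end

theory Submission
  imports Defs "HOL-Real_Asymp.Real_Asymp"
begin

text \<open>The inequality is the product of three inequalities of the shape
  \<open>b\<^sub>1\<^sub>1\<^sub>1 b\<^sub>3\<^sub>0\<^sub>0 \<le> b\<^sub>2\<^sub>1\<^sub>0 b\<^sub>2\<^sub>0\<^sub>1\<close>, one for each color (\<open>correlation\<close>). Such an inequality is
  a sum, over elements \<open>e\<close> of the second and \<open>f\<close> of the third color, of an inequality about the
  set \<open>A\<close> of elements of the first color: the number of bases inside \<open>A\<close>, times the number of
  \<open>x \<in> A\<close> that complete \<open>e, f\<close> to a basis, is at most the number of pairs in \<open>A\<close> that complete
  \<open>e\<close>, times the number of those that complete \<open>f\<close>. This is an instance of Wagner's theorem that
  rank-three matroids are Rayleigh (\<open>rayleigh\<close>).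

  For its proof, view the matroid as a configuration of points in a plane. A point off the line
  \<open>e f\<close> lies on one line through \<open>e\<close> and on one through \<open>f\<close>, and these two lines determine it up
  to parallel elements. So the elements of \<open>A\<close> off \<open>e f\<close> are entries of a matrix whose rows and
  columns are the lines through \<open>e\<close> and through \<open>f\<close>. A pair of them completes \<open>e\<close> if it meets
  two rows, and it completes \<open>f\<close> if it meets two columns, while a basis must occupy three
  different cells that are not all in one row or in one column. The resulting inequality about
  matrices (\<open>grid_inequality\<close>) holds because the difference of its sides is at least a sum of
  squares. The elements of \<open>A\<close> on the line \<open>e f\<close> contribute terms that are compared one by one
  through basis exchange.

  For the sharpness, take a direct sum of three parallel classes, whose basis generating
  polynomial by colors is a product of three linear forms. If class \<open>j\<close> has \<open>n\<close> elements of
  color \<open>j\<close> and one of each other color, the ratio of the two sides tends to 1 as \<open>n\<close> grows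
  (\<open>constant_sharp\<close>).\<close>

section \<open>An inequality for positions in a matrix\<close>

definition same :: "('a \<Rightarrow> 'b) \<Rightarrow> 'a \<Rightarrow> 'a \<Rightarrow> real" where
  "same f x y = of_bool (f x = f y)"

lemma same_commute: "same f x y = same f y x"
  by (auto simp: same_def)

lemma sum_triple_swap12:
  "(\<Sum>x\<in>X. \<Sum>y\<in>X. \<Sum>z\<in>X. F x y z) = (\<Sum>x\<in>X. \<Sum>y\<in>X. \<Sum>z\<in>X. F y x z)"
  for F :: "_ \<Rightarrow> _ \<Rightarrow> _ \<Rightarrow> 'b::comm_monoid_add"
  by (rule sum.swap)

lemma sum_triple_swap23:
  "(\<Sum>x\<in>X. \<Sum>y\<in>X. \<Sum>z\<in>X. F x y z) = (\<Sum>x\<in>X. \<Sum>y\<in>X. \<Sum>z\<in>X. F x z y)"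
  for F :: "_ \<Rightarrow> _ \<Rightarrow> _ \<Rightarrow> 'b::comm_monoid_add"
  by (intro sum.cong refl sum.swap)

text \<open>Each pair of elements in a common fibre of \<open>f\<close> is seen by exactly one value \<open>i\<close>.
  This converts sums over rows, columns and cells into sums over elements, where no matrix is
  visible any more.\<close>

lemma sum_indicator_products:
  assumes "finite X" "x \<in> X"
  shows "(\<Sum>i\<in>f ` X. of_bool (f x = i) * of_bool (f y = i)) = same f x y"
proof -
  have "(\<Sum>i\<in>f ` X. of_bool (f x = i) * of_bool (f y = i) :: real)
      = (\<Sum>i\<in>f ` X. if f x = i then of_bool (f y = f x) else 0)"
    by (intro sum.cong) auto
  also have "\<dots> = of_bool (f y = f x)"
    using assms by (subst sum.delta') auto
  finally show ?thesis by (auto simp: same_def)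
qed

text \<open>Place the elements of \<open>X\<close> in a matrix, \<open>x\<close> in row \<open>f x\<close> and column \<open>g x\<close>, and let \<open>w\<^sub>i\<^sub>j\<close>, \<open>r\<^sub>i\<close>,
  \<open>c\<^sub>j\<close> count the elements of a cell, a row and a column. The bound is the expansion of
  \<open>0 \<le> \<Sum> (m w\<^sub>i\<^sub>j - r\<^sub>i c\<^sub>j)\<^sup>2\<close>, whose terms are the numbers of pairs or triples of elements with the
  indicated coincidences. It measures the distance of the distribution of cells from a product
  distribution, and it is the only inequality in the argument that is not a comparison of
  individual terms.\<close>

lemma cell_square_bound:
  fixes f :: "'a \<Rightarrow> 'b" and g :: "'a \<Rightarrow> 'c"
  assumes "finite X"
  defines "m \<equiv> real (card X)"
  shows "2 * m * (\<Sum>x\<in>X. \<Sum>y\<in>X. \<Sum>z\<in>X. same f x y * same g x z)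
    \<le> m\<^sup>2 * (\<Sum>x\<in>X. \<Sum>y\<in>X. same f x y * same g x y)
      + (\<Sum>x\<in>X. \<Sum>y\<in>X. same f x y) * (\<Sum>x\<in>X. \<Sum>y\<in>X. same g x y)"
proof -
  define a where "a = (\<lambda>i x. of_bool (f x = i) :: real)"
  define b where "b = (\<lambda>j x. of_bool (g x = j) :: real)"
  define r where "r = (\<lambda>i. \<Sum>x\<in>X. a i x)"
  define c where "c = (\<lambda>j. \<Sum>x\<in>X. b j x)"
  define w where "w = (\<lambda>i j. \<Sum>x\<in>X. a i x * b j x)"
  have sa: "(\<Sum>i\<in>f ` X. a i x * a i y) = same f x y" if "x \<in> X" for x y
    unfolding a_def using sum_indicator_products[OF assms(1) that] .
  have sb: "(\<Sum>i\<in>g ` X. b i x * b i y) = same g x y" if "x \<in> X" for x y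
    unfolding b_def using sum_indicator_products[OF assms(1) that] .
  have ww: "(\<Sum>i\<in>f ` X. \<Sum>j\<in>g ` X. (w i j)\<^sup>2) = (\<Sum>x\<in>X. \<Sum>y\<in>X. same f x y * same g x y)"
  proof -
    have "(\<Sum>i\<in>f ` X. \<Sum>j\<in>g ` X. (w i j)\<^sup>2)
        = (\<Sum>i\<in>f ` X. \<Sum>j\<in>g ` X. \<Sum>x\<in>X. \<Sum>y\<in>X. (a i x * a i y) * (b j x * b j y))"
      unfolding w_def power2_eq_square sum_product
      by (intro sum.cong refl) (simp add: mult_ac)
    also have "\<dots> = (\<Sum>i\<in>f ` X. \<Sum>x\<in>X. \<Sum>y\<in>X. \<Sum>j\<in>g ` X. (a i x * a i y) * (b j x * b j y))"
      by (subst sum.swap, subst (2) sum.swap) (rule refl)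
    also have "\<dots> = (\<Sum>x\<in>X. \<Sum>y\<in>X. \<Sum>i\<in>f ` X. \<Sum>j\<in>g ` X. (a i x * a i y) * (b j x * b j y))"
      by (subst sum.swap, subst (2) sum.swap) (rule refl)
    also have "\<dots> = (\<Sum>x\<in>X. \<Sum>y\<in>X. same f x y * same g x y)"
      by (intro sum.cong refl) (simp add: sum_product[symmetric] sa sb)
    finally show ?thesis .
  qed
  have wrc: "(\<Sum>i\<in>f ` X. \<Sum>j\<in>g ` X. w i j * (r i * c j))
      = (\<Sum>x\<in>X. \<Sum>y\<in>X. \<Sum>z\<in>X. same f x y * same g x z)"
  proof -
    have "(\<Sum>i\<in>f ` X. \<Sum>j\<in>g ` X. w i j * (r i * c j))
        = (\<Sum>i\<in>f ` X. \<Sum>j\<in>g ` X. \<Sum>x\<in>X. (a i x * r i) * (b j x * c j))"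
      unfolding w_def sum_distrib_right by (intro sum.cong refl) (simp add: mult_ac)
    also have "\<dots> = (\<Sum>i\<in>f ` X. \<Sum>x\<in>X. \<Sum>j\<in>g ` X. (a i x * r i) * (b j x * c j))"
      by (intro sum.cong refl sum.swap)
    also have "\<dots> = (\<Sum>x\<in>X. \<Sum>i\<in>f ` X. \<Sum>j\<in>g ` X. (a i x * r i) * (b j x * c j))"
      by (rule sum.swap)
    also have "\<dots> = (\<Sum>x\<in>X. (\<Sum>i\<in>f ` X. a i x * r i) * (\<Sum>j\<in>g ` X. b j x * c j))"
      by (simp add: sum_product)
    also have "\<dots> = (\<Sum>x\<in>X. (\<Sum>y\<in>X. same f x y) * (\<Sum>z\<in>X. same g x z))"
    proof (intro sum.cong refl)
      fix x assume x: "x \<in> X"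
      have "(\<Sum>i\<in>f ` X. a i x * r i) = (\<Sum>y\<in>X. same f x y)"
        unfolding r_def sum_distrib_left by (subst sum.swap) (simp add: sa x)
      moreover have "(\<Sum>j\<in>g ` X. b j x * c j) = (\<Sum>y\<in>X. same g x y)"
        unfolding c_def sum_distrib_left by (subst sum.swap) (simp add: sb x)
      ultimately show "(\<Sum>i\<in>f ` X. a i x * r i) * (\<Sum>j\<in>g ` X. b j x * c j)
          = (\<Sum>y\<in>X. same f x y) * (\<Sum>z\<in>X. same g x z)" by simp
    qed
    finally show ?thesis by (simp add: sum_product)
  qed
  have rr: "(\<Sum>i\<in>f ` X. (r i)\<^sup>2) = (\<Sum>x\<in>X. \<Sum>y\<in>X. same f x y)"
    unfolding r_def power2_eq_square sum_product
    by (subst sum.swap, intro sum.cong refl, subst sum.swap) (simp add: sa)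
  have cc: "(\<Sum>i\<in>g ` X. (c i)\<^sup>2) = (\<Sum>x\<in>X. \<Sum>y\<in>X. same g x y)"
    unfolding c_def power2_eq_square sum_product
    by (subst sum.swap, intro sum.cong refl, subst sum.swap) (simp add: sb)
  have "0 \<le> (\<Sum>i\<in>f ` X. \<Sum>j\<in>g ` X. (m * w i j - r i * c j)\<^sup>2)"
    by (intro sum_nonneg) simp
  also have "\<dots> = (\<Sum>i\<in>f ` X. \<Sum>j\<in>g ` X. m\<^sup>2 * (w i j)\<^sup>2 - 2 * m * (w i j * (r i * c j)) + (r i)\<^sup>2 * (c j)\<^sup>2)"
    by (intro sum.cong refl) (simp add: power2_eq_square algebra_simps)
  also have "\<dots> = m\<^sup>2 * (\<Sum>i\<in>f ` X. \<Sum>j\<in>g ` X. (w i j)\<^sup>2)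
      - 2 * m * (\<Sum>i\<in>f ` X. \<Sum>j\<in>g ` X. w i j * (r i * c j))
      + (\<Sum>i\<in>f ` X. (r i)\<^sup>2) * (\<Sum>i\<in>g ` X. (c i)\<^sup>2)"
    unfolding sum_product by (simp add: sum.distrib sum_subtractf sum_distrib_left)
  finally show ?thesis unfolding ww wrc rr cc by linarith
qed

text \<open>The right-hand side depends only on the coincidences among three positions of the matrix.
  It vanishes when two of them are in the same cell or all three are in one row or column;
  otherwise it is 3 if no two share a row or a column, and 2 in every other case. Summed over all
  triples, its mixed products become the cross term of \<open>cell_square_bound\<close>.\<close>

lemma noncollinear_triple_bound:
  assumes "T \<Longrightarrow> \<not> (f x = f y \<and> g x = g y)"
    and "T \<Longrightarrow> \<not> (f x = f z \<and> g x = g z)"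
    and "T \<Longrightarrow> \<not> (f y = f z \<and> g y = g z)"
    and "T \<Longrightarrow> \<not> (f x = f y \<and> f y = f z)"
    and "T \<Longrightarrow> \<not> (g x = g y \<and> g y = g z)"
  shows "2 * of_bool T \<le> 3
    - (same f x y + same f x z + same f y z) - (same g x y + same g x z + same g y z)
    + (same f x y * same g x z + same f x z * same g x y + same f x y * same g y z
       + same f y z * same g x y + same f x z * same g y z + same f y z * same g x z)
    - (same f x y * same g x y + same f x z * same g x z + same f y z * same g y z)"
proof -
  \<comment> \<open>Only the transitivity of the two coincidence relations matters, so a truth table suffices.\<close>
  have bool_case: "2 * of_bool T \<le> (3 :: real)
    - (of_bool p + of_bool q + of_bool r) - (of_bool s + of_bool t + of_bool u)
    + (of_bool p * of_bool t + of_bool q * of_bool s + of_bool p * of_bool u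
       + of_bool r * of_bool s + of_bool q * of_bool u + of_bool r * of_bool t)
    - (of_bool p * of_bool s + of_bool q * of_bool t + of_bool r * of_bool u)"
    if "p \<Longrightarrow> q = r" "q \<Longrightarrow> p = r" "s \<Longrightarrow> t = u" "t \<Longrightarrow> s = u"
      "T \<Longrightarrow> \<not> (p \<and> s) \<and> \<not> (q \<and> t) \<and> \<not> (r \<and> u) \<and> \<not> (p \<and> r) \<and> \<not> (s \<and> u)"
    for p q r s t u T
    using that by (cases p; cases q; cases r; cases s; cases t; cases u; cases T) simp_all
  show ?thesis
    unfolding same_def by (rule bool_case) (use assms in auto)
qed

text \<open>Let there be \<open>m\<close> elements, \<open>R\<close> ordered pairs in different rows, \<open>C\<close> ordered pairs in
  different columns, and \<open>t\<close> ordered triples in three different cells that do not all lie in one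
  row or in one column. With \<open>w\<^sub>i\<^sub>j\<close>, \<open>r\<^sub>i\<close>, \<open>c\<^sub>j\<close> as above, the proof rests on the identity
  \<open>3 R C - 2 m t = 3 \<Sum> (m w\<^sub>i\<^sub>j - r\<^sub>i c\<^sub>j)\<^sup>2 + m s\<close>, where \<open>s\<close> is the number of ordered triples
  with no two positions in a common row or column.\<close>

lemma grid_inequality:
  fixes f :: "'a \<Rightarrow> 'b" and g :: "'a \<Rightarrow> 'c"
  assumes fin: "finite X"
    and cell12: "\<And>x y z. x \<in> X \<Longrightarrow> y \<in> X \<Longrightarrow> z \<in> X \<Longrightarrow> T x y z \<Longrightarrow> \<not> (f x = f y \<and> g x = g y)"
    and cell13: "\<And>x y z. x \<in> X \<Longrightarrow> y \<in> X \<Longrightarrow> z \<in> X \<Longrightarrow> T x y z \<Longrightarrow> \<not> (f x = f z \<and> g x = g z)"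
    and cell23: "\<And>x y z. x \<in> X \<Longrightarrow> y \<in> X \<Longrightarrow> z \<in> X \<Longrightarrow> T x y z \<Longrightarrow> \<not> (f y = f z \<and> g y = g z)"
    and row: "\<And>x y z. x \<in> X \<Longrightarrow> y \<in> X \<Longrightarrow> z \<in> X \<Longrightarrow> T x y z \<Longrightarrow> \<not> (f x = f y \<and> f y = f z)"
    and col: "\<And>x y z. x \<in> X \<Longrightarrow> y \<in> X \<Longrightarrow> z \<in> X \<Longrightarrow> T x y z \<Longrightarrow> \<not> (g x = g y \<and> g y = g z)"
  shows "2 * real (card X) * (\<Sum>x\<in>X. \<Sum>y\<in>X. \<Sum>z\<in>X. of_bool (T x y z))
    \<le> 3 * (\<Sum>x\<in>X. \<Sum>y\<in>X. of_bool (f x \<noteq> f y)) * (\<Sum>x\<in>X. \<Sum>y\<in>X. of_bool (g x \<noteq> g y))"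
proof -
  define m where "m = real (card X)"
  define \<rho> where "\<rho> = (\<Sum>x\<in>X. \<Sum>y\<in>X. same f x y)"
  define \<kappa> where "\<kappa> = (\<Sum>x\<in>X. \<Sum>y\<in>X. same g x y)"
  define p where "p = (\<Sum>x\<in>X. \<Sum>y\<in>X. same f x y * same g x y)"
  define q where "q = (\<Sum>x\<in>X. \<Sum>y\<in>X. \<Sum>z\<in>X. same f x y * same g x z)"
  define t where "t = (\<Sum>x\<in>X. \<Sum>y\<in>X. \<Sum>z\<in>X. of_bool (T x y z) :: real)"
  have pairs: "(\<Sum>x\<in>X. \<Sum>y\<in>X. \<Sum>z\<in>X. F x y) = m * (\<Sum>x\<in>X. \<Sum>y\<in>X. F x y)"
    "(\<Sum>x\<in>X. \<Sum>y\<in>X. \<Sum>z\<in>X. F x z) = m * (\<Sum>x\<in>X. \<Sum>y\<in>X. F x y)"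
    "(\<Sum>x\<in>X. \<Sum>y\<in>X. \<Sum>z\<in>X. F y z) = m * (\<Sum>x\<in>X. \<Sum>y\<in>X. F x y)"
    for F :: "'a \<Rightarrow> 'a \<Rightarrow> real"
    by (simp_all add: m_def sum_distrib_left)
  have q2: "(\<Sum>x\<in>X. \<Sum>y\<in>X. \<Sum>z\<in>X. same f x z * same g x y) = q"
    unfolding q_def by (rule sum_triple_swap23)
  have q3: "(\<Sum>x\<in>X. \<Sum>y\<in>X. \<Sum>z\<in>X. same f x y * same g y z) = q"
    unfolding q_def by (subst sum_triple_swap12) (simp add: same_commute)
  have q4: "(\<Sum>x\<in>X. \<Sum>y\<in>X. \<Sum>z\<in>X. same f y z * same g x y) = q"
    unfolding q2[symmetric] by (subst sum_triple_swap12) (simp add: same_commute)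
  have q5: "(\<Sum>x\<in>X. \<Sum>y\<in>X. \<Sum>z\<in>X. same f x z * same g y z) = q"
    unfolding q3[symmetric] by (subst sum_triple_swap23) (simp add: same_commute)
  have q6: "(\<Sum>x\<in>X. \<Sum>y\<in>X. \<Sum>z\<in>X. same f y z * same g x z) = q"
    unfolding q4[symmetric] by (subst sum_triple_swap23) (simp add: same_commute)
  have "2 * t = (\<Sum>x\<in>X. \<Sum>y\<in>X. \<Sum>z\<in>X. 2 * of_bool (T x y z))"
    by (simp add: t_def sum_distrib_left)
  also have "\<dots> \<le> (\<Sum>x\<in>X. \<Sum>y\<in>X. \<Sum>z\<in>X. 3
    - (same f x y + same f x z + same f y z) - (same g x y + same g x z + same g y z)
    + (same f x y * same g x z + same f x z * same g x y + same f x y * same g y z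
       + same f y z * same g x y + same f x z * same g y z + same f y z * same g x z)
    - (same f x y * same g x y + same f x z * same g x z + same f y z * same g y z))"
    by (intro sum_mono noncollinear_triple_bound) (fact cell12 cell13 cell23 row col)+
  also have "\<dots> = 3 * m ^ 3 - 3 * m * \<rho> - 3 * m * \<kappa> + 6 * q - 3 * m * p"
    unfolding sum.distrib sum_subtractf q2 q3 q4 q5 q6 q_def[symmetric]
      pairs pairs[of "\<lambda>x y. same f x y * same g x y"] \<rho>_def[symmetric] \<kappa>_def[symmetric] p_def[symmetric]
    by (simp add: m_def power3_eq_cube)
  finally have t: "2 * t \<le> 3 * m ^ 3 - 3 * m * \<rho> - 3 * m * \<kappa> + 6 * q - 3 * m * p" .
  have sq: "2 * m * q \<le> m\<^sup>2 * p + \<rho> * \<kappa>"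
    unfolding m_def q_def p_def \<rho>_def \<kappa>_def by (rule cell_square_bound[OF fin])
  have R: "(\<Sum>x\<in>X. \<Sum>y\<in>X. of_bool (f x \<noteq> f y)) = m\<^sup>2 - \<rho>"
    by (simp add: \<rho>_def same_def m_def of_bool_not_iff sum_subtractf power2_eq_square)
  have C: "(\<Sum>x\<in>X. \<Sum>y\<in>X. of_bool (g x \<noteq> g y)) = m\<^sup>2 - \<kappa>"
    by (simp add: \<kappa>_def same_def m_def of_bool_not_iff sum_subtractf power2_eq_square)
  have "m * (2 * t) \<le> m * (3 * m ^ 3 - 3 * m * \<rho> - 3 * m * \<kappa> + 6 * q - 3 * m * p)"
    by (rule mult_left_mono[OF t]) (simp add: m_def)
  also have "\<dots> \<le> 3 * (m\<^sup>2 - \<rho>) * (m\<^sup>2 - \<kappa>)"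
    using sq by (simp add: algebra_simps power2_eq_square power3_eq_cube)
  finally show ?thesis unfolding R C by (simp add: m_def t_def mult_ac)
qed

section \<open>The Rayleigh inequality for a pair of elements\<close>

text \<open>The exchange property for ordered bases is all that the correlation inequality uses about a
  rank-three matroid. All the geometry of lines that is needed below consists of single
  applications of it.\<close>

locale ternary_bases =
  fixes B :: "'a \<Rightarrow> 'a \<Rightarrow> 'a \<Rightarrow> bool"
  assumes swap12: "B x y z \<Longrightarrow> B y x z"
    and swap23: "B x y z \<Longrightarrow> B x z y"
    and distinct12: "\<not> B x x y"
    and exchange: "B x y z \<Longrightarrow> B u v w \<Longrightarrow> B u y z \<or> B v y z \<or> B w y z"
begin

lemma swap12_iff: "B x y z \<longleftrightarrow> B y x z"
  using swap12 by blast

lemma swap23_iff: "B x y z \<longleftrightarrow> B x z y"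
  using swap23 by blast

lemma rotate: "B x y z \<Longrightarrow> B y z x"
  using swap12 swap23 by blast

lemma distinct23: "\<not> B x y y" and distinct13: "\<not> B x y x"
  using distinct12 swap12_iff swap23_iff by blast+

lemma exchange2: "B x y z \<Longrightarrow> B u v w \<Longrightarrow> B x u z \<or> B x v z \<or> B x w z"
  using exchange swap12 by blast

lemma exchange3: "B x y z \<Longrightarrow> B u v w \<Longrightarrow> B x y u \<or> B x y v \<or> B x y w"
  using exchange2 swap23 by blast

text \<open>For points off the line \<open>e f\<close>, lying on a common line through \<open>e\<close> is an equivalence relation;
  a line through \<open>e\<close> is represented by the set of its points in \<open>X\<close>.\<close>

lemma same_line_iff:
  assumes X: "X = {x \<in> A. B e f x}" and x: "x \<in> X" and y: "y \<in> X"
  shows "{z \<in> X. \<not> B e x z} = {z \<in> X. \<not> B e y z} \<longleftrightarrow> \<not> B e x y"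
proof
  assume "{z \<in> X. \<not> B e x z} = {z \<in> X. \<not> B e y z}"
  then show "\<not> B e x y" using y distinct23 by blast
next
  have trans: "\<not> B e u w" if "\<not> B e u v" "\<not> B e v w" "v \<in> X" for u v w
  proof
    assume "B e u w"
    moreover have "B e f v" using that X by simp
    ultimately have "B e e v \<or> B e u v \<or> B e w v" using exchange2 by blast
    then show False using that distinct12 swap23 by blast
  qed
  assume "\<not> B e x y"
  then have "\<not> B e y x" using swap23 by blast
  then show "{z \<in> X. \<not> B e x z} = {z \<in> X. \<not> B e y z}"
    using trans \<open>\<not> B e x y\<close> x y by blast
qed

text \<open>The lines through \<open>e\<close> serve as rows and the lines through \<open>f\<close> as columns. Two points in the
  same cell are parallel, because the two lines through them meet in rank one, so no basis contains
  both; and three points on one line are dependent. Hence every basis inside \<open>X\<close> is a triple to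
  which the grid inequality applies.\<close>

lemma off_line_inequality:
  assumes fin: "finite A" and X_def: "X = {x \<in> A. B e f x}"
  shows "2 * real (card X) * (\<Sum>x\<in>X. \<Sum>y\<in>X. \<Sum>z\<in>X. of_bool (B x y z))
    \<le> 3 * (\<Sum>x\<in>X. \<Sum>y\<in>X. of_bool (B e x y)) * (\<Sum>x\<in>X. \<Sum>y\<in>X. of_bool (B f x y))"
proof -
  define row where "row = (\<lambda>x. {z \<in> X. \<not> B e x z})"
  define col where "col = (\<lambda>x. {z \<in> X. \<not> B f x z})"
  have row: "row x = row y \<longleftrightarrow> \<not> B e x y" if "x \<in> X" "y \<in> X" for x y
    unfolding row_def using that by (intro same_line_iff[of X A e f]) (auto simp: X_def)
  have "X = {x \<in> A. B f e x}" unfolding X_def using swap12_iff by blast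
  then have col: "col x = col y \<longleftrightarrow> \<not> B f x y" if "x \<in> X" "y \<in> X" for x y
    unfolding col_def using that by (intro same_line_iff[of X A f e])
  have efx: "B e f x" "B f e x" if "x \<in> X" for x
    using that swap12 unfolding X_def by blast+
  have cell: "B e x y \<or> B f x y" if "B x y z" "x \<in> X" for x y z
    using exchange3[OF that(1) efx(1)[OF that(2)]] distinct13 distinct12 swap12_iff swap23_iff by metis
  have line: "B d x y \<or> B d x z" if "B x y z" "B d d' x" for d d' x y z
    using exchange2[OF that(2,1)] distinct23 swap23_iff by metis
  have "2 * real (card X) * (\<Sum>x\<in>X. \<Sum>y\<in>X. \<Sum>z\<in>X. of_bool (B x y z))
    \<le> 3 * (\<Sum>x\<in>X. \<Sum>y\<in>X. of_bool (row x \<noteq> row y)) * (\<Sum>x\<in>X. \<Sum>y\<in>X. of_bool (col x \<noteq> col y))"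
  proof (rule grid_inequality)
    show "finite X" using fin by (simp add: X_def)
  next
    fix x y z assume xyz: "x \<in> X" "y \<in> X" "z \<in> X" "B x y z"
    show "\<not> (row x = row y \<and> col x = col y)"
      using cell[of x y z] xyz row col by blast
    show "\<not> (row x = row z \<and> col x = col z)"
      using cell[OF swap23[OF xyz(4)]] xyz row col by blast
    show "\<not> (row y = row z \<and> col y = col z)"
      using cell[OF rotate[OF xyz(4)]] xyz row col by blast
    show "\<not> (row x = row y \<and> row y = row z)"
      using line[OF xyz(4) efx(1)] xyz row[of x y] row[of x z] by metis
    show "\<not> (col x = col y \<and> col y = col z)"
      using line[OF xyz(4) efx(2)] xyz col[of x y] col[of x z] by metis
  qed
  also have "(\<Sum>x\<in>X. \<Sum>y\<in>X. of_bool (row x \<noteq> row y)) = (\<Sum>x\<in>X. \<Sum>y\<in>X. of_bool (B e x y) :: real)"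
    by (intro sum.cong refl) (simp add: row)
  also have "(\<Sum>x\<in>X. \<Sum>y\<in>X. of_bool (col x \<noteq> col y)) = (\<Sum>x\<in>X. \<Sum>y\<in>X. of_bool (B f x y) :: real)"
    by (intro sum.cong refl) (simp add: col)
  finally show ?thesis .
qed

text \<open>The factors 3 count the positions that the odd element can take in an ordered triple.\<close>

lemma sum_triple_split:
  fixes X K :: "'a set"
  assumes "finite X" "finite K" "X \<inter> K = {}"
    and none: "\<And>k l n. k \<in> K \<Longrightarrow> l \<in> K \<Longrightarrow> n \<in> K \<Longrightarrow> \<not> B k l n"
  shows "(\<Sum>x\<in>X \<union> K. \<Sum>y\<in>X \<union> K. \<Sum>z\<in>X \<union> K. of_bool (B x y z) :: real)
    = (\<Sum>x\<in>X. \<Sum>y\<in>X. \<Sum>z\<in>X. of_bool (B x y z))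
      + 3 * (\<Sum>x\<in>X. \<Sum>y\<in>X. \<Sum>k\<in>K. of_bool (B x y k))
      + 3 * (\<Sum>x\<in>X. \<Sum>k\<in>K. \<Sum>l\<in>K. of_bool (B x k l))"
proof -
  let ?b = "\<lambda>x y z. of_bool (B x y z) :: real"
  have b23: "?b x y z = ?b x z y" and b12: "?b x y z = ?b y x z" for x y z
    using swap23_iff swap12_iff by auto
  have XKX: "(\<Sum>x\<in>X. \<Sum>k\<in>K. \<Sum>y\<in>X. ?b x k y) = (\<Sum>x\<in>X. \<Sum>y\<in>X. \<Sum>k\<in>K. ?b x y k)"
    by (rule sum.cong[OF refl], subst sum.swap) (simp add: b23)
  have KXX: "(\<Sum>k\<in>K. \<Sum>x\<in>X. \<Sum>y\<in>X. ?b k x y) = (\<Sum>x\<in>X. \<Sum>y\<in>X. \<Sum>k\<in>K. ?b x y k)"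
    unfolding XKX[symmetric] by (subst sum.swap) (intro sum.cong refl b12)
  have KXK: "(\<Sum>k\<in>K. \<Sum>x\<in>X. \<Sum>l\<in>K. ?b k x l) = (\<Sum>x\<in>X. \<Sum>k\<in>K. \<Sum>l\<in>K. ?b x k l)"
    by (subst sum.swap) (intro sum.cong refl b12)
  have KKX: "(\<Sum>k\<in>K. \<Sum>l\<in>K. \<Sum>x\<in>X. ?b k l x) = (\<Sum>x\<in>X. \<Sum>k\<in>K. \<Sum>l\<in>K. ?b x k l)"
    unfolding KXK[symmetric] by (rule sum.cong[OF refl], subst sum.swap) (simp add: b23)
  have KKK: "(\<Sum>k\<in>K. \<Sum>l\<in>K. \<Sum>n\<in>K. ?b k l n) = 0"
    using none by simp
  show ?thesis
    using KXX KXK KKX KKK XKX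
    by (simp add: sum.union_disjoint[OF assms(1-3)] sum.distrib)
qed

text \<open>This is the Rayleigh inequality of rank-three matroids (Wagner) for the pair \<open>e, f\<close>, with
  ordered bases. Let \<open>X\<close> consist of the elements of \<open>A\<close> that complete \<open>e, f\<close>, and \<open>K\<close> of the
  others. If \<open>X\<close> is nonempty, then \<open>K\<close> lies on the line \<open>e f\<close>, so a basis has at most two elements
  in \<open>K\<close>. The bases inside \<open>X\<close> are handled by \<open>off_line_inequality\<close>. The others can be
  compared term by term with the cross terms of the product on the right, since whether \<open>k \<in> K\<close>
  completes \<open>e, x\<close> to a basis is the same for all \<open>x \<in> X\<close>.\<close>

theorem rayleigh:
  assumes fin: "finite A"
  shows "2 * (\<Sum>x\<in>A. of_bool (B e f x)) * (\<Sum>x\<in>A. \<Sum>y\<in>A. \<Sum>z\<in>A. of_bool (B x y z))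
    \<le> 3 * (\<Sum>x\<in>A. \<Sum>y\<in>A. of_bool (B e x y)) * (\<Sum>x\<in>A. \<Sum>y\<in>A. of_bool (B f x y) :: real)"
proof (cases "\<exists>x\<in>A. B e f x")
  case False
  then show ?thesis by (simp add: sum_nonneg)
next
  case True
  define X where "X = {x \<in> A. B e f x}"
  define K where "K = {x \<in> A. \<not> B e f x}"
  obtain v where v: "v \<in> X" "B e f v" using True by (auto simp: X_def)
  have A: "A = X \<union> K" and XK: "finite X" "finite K" "X \<inter> K = {}"
    using fin by (auto simp: X_def K_def)
  define m where "m = real (card X)"
  \<comment> \<open>The elements of \<open>K\<close> that are neither loops nor parallel to \<open>e\<close>, respectively \<open>f\<close>.\<close>
  define Ke where "Ke = {k \<in> K. B e v k}"
  define Kf where "Kf = {k \<in> K. B f v k}"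
  have efx: "B e f x" "B f e x" if "x \<in> X" for x
    using that swap12 unfolding X_def by blast+
  have no: "\<not> B e f k" "\<not> B f e k" if "k \<in> K" for k
    using that swap12 unfolding K_def by blast+
  have move: "B d x' k" if "B d x k" "B d d' x'" "\<not> B d d' k" for d d' x x' k
    using exchange2[OF that(1,2)] that(3) distinct12 by metis
  have Ke: "B e x k \<longleftrightarrow> k \<in> Ke" and Kf: "B f x k \<longleftrightarrow> k \<in> Kf" if "x \<in> X" "k \<in> K" for x k
    using move[of e _ k f] move[of f _ k e] efx[OF that(1)] efx[OF v(1)] no[OF that(2)] that
    unfolding Ke_def Kf_def by blast+
  have on: "B e f k \<or> B e f l \<or> B e f n" if "B k l n" for k l n
    using exchange3[OF v(2) that] .
  have onl: "\<not> B d k l" if "d = e \<or> d = f" "k \<in> K" "l \<in> K" for d k l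
    using on[of d k l] that no distinct13 distinct23 by blast
  have pair_sum: "(\<Sum>x\<in>A. \<Sum>y\<in>A. of_bool (B d x y) :: real)
      = (\<Sum>x\<in>X. \<Sum>y\<in>X. of_bool (B d x y)) + 2 * m * card Kd"
    if d: "d = e \<or> d = f" and Kd: "Kd \<subseteq> K" "\<And>x k. x \<in> X \<Longrightarrow> k \<in> K \<Longrightarrow> B d x k \<longleftrightarrow> k \<in> Kd"
    for d Kd
  proof -
    have xk: "(\<Sum>x\<in>X. \<Sum>k\<in>K. of_bool (B d x k) :: real) = m * card Kd"
    proof -
      have "(\<Sum>x\<in>X. \<Sum>k\<in>K. of_bool (B d x k) :: real) = (\<Sum>x\<in>X. \<Sum>k\<in>K. of_bool (k \<in> Kd))"
        by (intro sum.cong refl) (simp add: Kd(2))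
      also have "\<dots> = m * card Kd" using Kd(1) XK(2)
        by (simp add: m_def Int_absorb1)
      finally show ?thesis .
    qed
    moreover have "(\<Sum>k\<in>K. \<Sum>x\<in>X. of_bool (B d k x) :: real) = m * card Kd"
      unfolding xk[symmetric] by (subst sum.swap) (intro sum.cong refl arg_cong[of _ _ of_bool] swap23_iff)
    moreover have "(\<Sum>k\<in>K. \<Sum>l\<in>K. of_bool (B d k l) :: real) = 0"
      using onl d by simp
    ultimately show ?thesis
      unfolding A by (simp add: sum.union_disjoint[OF XK] sum.distrib)
  qed
  define R where "R = (\<Sum>x\<in>X. \<Sum>y\<in>X. of_bool (B e x y) :: real)"
  define C where "C = (\<Sum>x\<in>X. \<Sum>y\<in>X. of_bool (B f x y) :: real)"
  have Te: "(\<Sum>x\<in>A. \<Sum>y\<in>A. of_bool (B e x y)) = R + 2 * m * card Ke"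
    unfolding R_def by (intro pair_sum) (auto simp: Ke, auto simp: Ke_def)
  have Tf: "(\<Sum>x\<in>A. \<Sum>y\<in>A. of_bool (B f x y)) = C + 2 * m * card Kf"
    unfolding C_def by (intro pair_sum) (auto simp: Kf, auto simp: Kf_def)
  have m: "(\<Sum>x\<in>A. of_bool (B e f x)) = m"
    using fin by (simp add: m_def X_def Int_def)
  define T3 where "T3 = (\<Sum>x\<in>X. \<Sum>y\<in>X. \<Sum>z\<in>X. of_bool (B x y z) :: real)"
  define T2 where "T2 = (\<Sum>x\<in>X. \<Sum>y\<in>X. \<Sum>k\<in>K. of_bool (B x y k) :: real)"
  define T1 where "T1 = (\<Sum>x\<in>X. \<Sum>k\<in>K. \<Sum>l\<in>K. of_bool (B x k l) :: real)"
  have T: "(\<Sum>x\<in>A. \<Sum>y\<in>A. \<Sum>z\<in>A. of_bool (B x y z)) = T3 + 3 * T2 + 3 * T1"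
    unfolding A T3_def T2_def T1_def using on no by (intro sum_triple_split XK) blast
  have T3: "2 * m * T3 \<le> 3 * R * C"
    unfolding m_def T3_def R_def C_def by (rule off_line_inequality[OF fin X_def])
  have sumK: "(\<Sum>k\<in>K. of_bool (k \<in> Ke)) = real (card Ke)"
     "(\<Sum>k\<in>K. of_bool (k \<in> Kf)) = real (card Kf)"
    using XK(2) by (simp_all add: Ke_def Kf_def Int_def)
  have T2: "T2 \<le> card Kf * R + card Ke * C"
  proof -
    have "T2 \<le> (\<Sum>x\<in>X. \<Sum>y\<in>X. \<Sum>k\<in>K. of_bool (B e x y) * of_bool (k \<in> Kf) + of_bool (B f x y) * of_bool (k \<in> Ke))"
      unfolding T2_def
    proof (intro sum_mono)
      fix x y k assume x: "x \<in> X" and k: "k \<in> K"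
      \<comment> \<open>Both alternatives fail only if one condition of each does. For each of the four choices, the
        basis \<open>x, y, k\<close> would contain a loop or a parallel pair or lie on a line through \<open>e\<close> or \<open>f\<close>.\<close>
      have "B f x k \<and> B e x y \<or> B e x k \<and> B f x y" if b: "B x y k"
      proof -
        have "B e x k \<or> B f x k"
          using exchange2[OF b efx(1)[OF x]] distinct12 swap12_iff by metis
        moreover have "B e x y \<or> B f x y"
          using exchange3[OF b efx(1)[OF x]] distinct13 swap12_iff swap23_iff by metis
        moreover have "B e x y \<or> B e x k"
          using exchange2[OF efx(1)[OF x] b] distinct23 swap23_iff by metis
        moreover have "B f x y \<or> B f x k"
          using exchange2[OF efx(2)[OF x] b] distinct23 swap23_iff by metis
        ultimately show ?thesis by blast
      qed
      then show "of_bool (B x y k) \<le> of_bool (B e x y) * of_bool (k \<in> Kf) + (of_bool (B f x y) * of_bool (k \<in> Ke) :: real)"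
        using Ke[OF x k] Kf[OF x k] by auto
    qed
    also have "\<dots> = card Kf * R + card Ke * C"
      by (simp add: sum.distrib R_def C_def sum_distrib_left[symmetric] sum_distrib_right[symmetric] sumK mult.commute)
    finally show ?thesis .
  qed
  have T1: "T1 \<le> 2 * m * card Ke * card Kf"
  proof -
    have "T1 \<le> (\<Sum>x\<in>X. \<Sum>k\<in>K. \<Sum>l\<in>K. of_bool (k \<in> Ke) * of_bool (l \<in> Kf) + of_bool (k \<in> Kf) * of_bool (l \<in> Ke))"
      unfolding T1_def
    proof (intro sum_mono)
      fix x k l assume x: "x \<in> X" and k: "k \<in> K" and l: "l \<in> K"
      \<comment> \<open>Independent \<open>k, l\<close> on the line \<open>e f\<close> can be matched with \<open>e, f\<close> so that matched
        elements are not parallel.\<close>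
      have "B e x k \<and> B f x l \<or> B f x k \<and> B e x l" if b: "B x k l"
      proof -
        have "B e x k \<or> B e x l"
          using exchange2[OF efx(1)[OF x] b] distinct23 swap23_iff by metis
        moreover have "B f x k \<or> B f x l"
          using exchange2[OF efx(2)[OF x] b] distinct23 swap23_iff by metis
        moreover have "B e x l \<or> B f x l"
          using exchange2[OF b efx(1)[OF x]] distinct12 swap12_iff by metis
        moreover have "B e x k \<or> B f x k"
          using exchange3[OF b efx(1)[OF x]] distinct13 swap12_iff swap23_iff by metis
        ultimately show ?thesis by blast
      qed
      then show "of_bool (B x k l) \<le> of_bool (k \<in> Ke) * of_bool (l \<in> Kf) + (of_bool (k \<in> Kf) * of_bool (l \<in> Ke) :: real)"
        using Ke[OF x k] Kf[OF x k] Ke[OF x l] Kf[OF x l] by auto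
    qed
    also have "\<dots> = 2 * m * card Ke * card Kf"
      by (simp add: sum.distrib sum_product[symmetric] sumK m_def)
    finally show ?thesis .
  qed
  have "2 * m * (T3 + 3 * T2 + 3 * T1)
      \<le> 3 * R * C + 6 * m * (card Kf * R + card Ke * C) + 6 * m * (2 * m * card Ke * card Kf)"
  proof -
    have "0 \<le> 6 * m" by (simp add: m_def)
    from T3 mult_left_mono[OF T2 this] mult_left_mono[OF T1 this] show ?thesis
      by (simp add: algebra_simps)
  qed
  also have "\<dots> = 3 * (R + 2 * m * card Ke) * (C + 2 * m * card Kf)"
    by (simp add: algebra_simps)
  finally show ?thesis unfolding T Te Tf m .
qed

end

section \<open>Counting colored bases\<close>

lemma card_by_fibres:
  assumes "finite S" and "\<And>t. t \<in> h ` S \<Longrightarrow> card {s \<in> S. h s = t} = k"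
  shows "card S = k * card (h ` S)"
proof -
  have "card S = (\<Sum>t\<in>h ` S. card {s \<in> S. h s = t})"
    using sum.group[of S "h ` S" h "\<lambda>_. 1::nat"] assms(1) by simp
  also have "\<dots> = k * card (h ` S)" using assms(2) by simp
  finally show ?thesis .
qed

locale rank_three_matroid = matroid E indep for E :: "'a set" and indep +
  assumes rank: "matroid_rank indep = 3"
begin

definition basis_triple :: "'a \<Rightarrow> 'a \<Rightarrow> 'a \<Rightarrow> bool" where
  "basis_triple x y z \<longleftrightarrow> indep {x, y, z} \<and> card {x, y, z} = 3"

lemma finite_indep: "indep X \<Longrightarrow> finite X"
  using indep_subset_ground finite_ground finite_subset by blast

lemma finite_indep_sets: "finite {X. indep X}"
  by (rule finite_subset[of _ "Pow E"]) (use indep_subset_ground finite_ground in auto)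

lemma card_indep_le: "indep X \<Longrightarrow> card X \<le> 3"
  using Max_ge[of "card ` {X. indep X}" "card X"] finite_indep_sets rank
  unfolding matroid_rank_def by auto

lemma ex_indep_3: "\<exists>X. indep X \<and> card X = 3"
proof -
  have "Max (card ` {X. indep X}) \<in> card ` {X. indep X}"
    using finite_indep_sets indep_empty by (intro Max_in) auto
  then show ?thesis using rank unfolding matroid_rank_def by auto
qed

text \<open>Augmentation makes all maximal independent sets equicardinal, so the bases are recognised by
  their size alone.\<close>

lemma bases_eq: "matroid_bases indep = {S. indep S \<and> card S = 3}"
proof (intro equalityI subsetI)
  fix S assume "S \<in> matroid_bases indep"
  then have S: "indep S" "\<And>X. indep X \<Longrightarrow> S \<subseteq> X \<Longrightarrow> X = S"
    by (auto simp: matroid_bases_def)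
  obtain Y where Y: "indep Y" "card Y = 3" using ex_indep_3 by blast
  have "card S = 3"
  proof (rule ccontr)
    assume "card S \<noteq> 3"
    then have "card S < card Y" using card_indep_le[OF S(1)] Y by simp
    then obtain y where "y \<in> Y - S" "indep (insert y S)" using indep_augment S(1) Y(1) by blast
    then show False using S(2)[of "insert y S"] by blast
  qed
  then show "S \<in> {S. indep S \<and> card S = 3}" using S by simp
next
  fix S assume "S \<in> {S. indep S \<and> card S = 3}"
  then have S: "indep S" "card S = 3" by auto
  have "X = S" if "indep X" "S \<subseteq> X" for X
    using card_seteq[OF finite_indep[OF that(1)] that(2)] card_indep_le[OF that(1)] S(2) by simp
  then show "S \<in> matroid_bases indep" using S by (auto simp: matroid_bases_def)
qed

lemma card_3_distinct: "card {x, y, z} = 3 \<longleftrightarrow> x \<noteq> y \<and> x \<noteq> z \<and> y \<noteq> z"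
  by (auto simp: card_insert_if)

lemma basis_tripleD: "basis_triple x y z \<Longrightarrow> x \<noteq> y \<and> x \<noteq> z \<and> y \<noteq> z"
  by (simp add: basis_triple_def card_3_distinct)

sublocale ternary_bases basis_triple
proof
  fix x y z u v w
  show "basis_triple x y z \<Longrightarrow> basis_triple y x z"
    by (simp add: basis_triple_def insert_commute)
  show "basis_triple x y z \<Longrightarrow> basis_triple x z y"
    by (simp add: basis_triple_def insert_commute)
  show "\<not> basis_triple x x y"
    unfolding basis_triple_def card_3_distinct by simp
  assume xyz: "basis_triple x y z" and uvw: "basis_triple u v w"
  have "indep {y, z}" using xyz indep_subset unfolding basis_triple_def by blast
  moreover have "card {y, z} = 2" using basis_tripleD[OF xyz] by simp
  moreover have "indep {u, v, w}" "card {u, v, w} = 3" using uvw by (simp_all add: basis_triple_def)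
  ultimately obtain t where t: "t \<in> {u, v, w} - {y, z}" "indep (insert t {y, z})"
    using indep_augment[of "{y, z}" "{u, v, w}"] by auto
  then have "basis_triple t y z"
    using basis_tripleD[OF xyz] by (simp add: basis_triple_def card_3_distinct)
  then show "basis_triple u y z \<or> basis_triple v y z \<or> basis_triple w y z" using t(1) by auto
qed

lemma basis_triple_iff_base: "basis_triple x y z \<longleftrightarrow> {x, y, z} \<in> matroid_bases indep \<and> x \<noteq> y \<and> x \<noteq> z \<and> y \<noteq> z"
  by (auto simp: basis_triple_def bases_eq card_3_distinct)

lemma base_subset: "S \<in> matroid_bases indep \<Longrightarrow> S \<subseteq> E"
  using indep_subset_ground by (simp add: bases_eq)

definition ordered_bases :: "'a set \<Rightarrow> 'a set \<Rightarrow> 'a set \<Rightarrow> ('a \<times> 'a \<times> 'a) set" where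
  "ordered_bases P Q R = {(x, y, z). x \<in> P \<and> y \<in> Q \<and> z \<in> R \<and> basis_triple x y z}"

lemma ordered_bases_subset: "ordered_bases P Q R \<subseteq> P \<times> Q \<times> R"
  by (auto simp: ordered_bases_def)

lemma card_ordered_bases:
  assumes "finite P" "finite Q" "finite R"
  shows "real (card (ordered_bases P Q R)) = (\<Sum>x\<in>P. \<Sum>y\<in>Q. \<Sum>z\<in>R. of_bool (basis_triple x y z))"
proof -
  have "(\<Sum>x\<in>P. \<Sum>y\<in>Q. \<Sum>z\<in>R. of_bool (basis_triple x y z) :: real)
      = (\<Sum>t\<in>P \<times> Q \<times> R. of_bool (t \<in> ordered_bases P Q R))"
    unfolding sum.cartesian_product by (intro sum.cong refl) (auto simp: ordered_bases_def)
  also have "\<dots> = card (P \<times> Q \<times> R \<inter> ordered_bases P Q R)"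
    using assms by (simp add: Int_def)
  also have "P \<times> Q \<times> R \<inter> ordered_bases P Q R = ordered_bases P Q R"
    using ordered_bases_subset by blast
  finally show ?thesis by simp
qed

definition underlying :: "'a \<times> 'a \<times> 'a \<Rightarrow> 'a set" where
  "underlying = (\<lambda>(x, y, z). {x, y, z})"

context
  fixes E1 E2 E3 :: "'a set"
  assumes col: "three_coloring E E1 E2 E3"
begin

lemma finite_classes: "finite E1" "finite E2" "finite E3"
  using col finite_ground by (auto simp: three_coloring_def)

lemma card_base_split:
  assumes "S \<in> matroid_bases indep"
  shows "card (S \<inter> E1) + card (S \<inter> E2) + card (S \<inter> E3) = 3"
proof -
  have fin: "finite S" and 3: "card S = 3" using assms finite_indep by (auto simp: bases_eq)
  have "card S = card ((S \<inter> E1) \<union> (S \<inter> E2) \<union> (S \<inter> E3))"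
    using base_subset[OF assms] col by (intro arg_cong[of _ _ card]) (auto simp: three_coloring_def)
  also have "\<dots> = card (S \<inter> E1) + card (S \<inter> E2) + card (S \<inter> E3)"
    using fin col by (subst card_Un_disjoint; (subst card_Un_disjoint)?) (auto simp: three_coloring_def)
  finally show ?thesis using 3 by simp
qed

lemma Int_insert3:
  "{x, y, z} \<inter> D = (if x \<in> D then {x} else {}) \<union> (if y \<in> D then {y} else {}) \<union> (if z \<in> D then {z} else {})"
  by auto

text \<open>The three counts below divide out the reorderings of a basis that preserve the prescribed
  colors: all six permutations, the exchange of the two entries of equal color, or only the
  identity.\<close>

lemma base_count_300: "card (ordered_bases E1 E1 E1) = 6 * base_count indep E1 E2 E3 3 0 0"
proof -
  let ?O = "ordered_bases E1 E1 E1"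
  have fin: "finite ?O" using finite_subset[OF ordered_bases_subset] finite_classes by blast
  have img: "underlying ` ?O = {S \<in> matroid_bases indep. card (S \<inter> E1) = 3 \<and> card (S \<inter> E2) = 0 \<and> card (S \<inter> E3) = 0}"
  proof (intro equalityI subsetI)
    fix S assume "S \<in> underlying ` ?O"
    then obtain x y z where xyz: "x \<in> E1" "y \<in> E1" "z \<in> E1" "basis_triple x y z" "S = {x, y, z}"
      by (auto simp: ordered_bases_def underlying_def)
    then have S: "S \<in> matroid_bases indep" using basis_triple_iff_base by simp
    have "S \<inter> E1 = S" using xyz by auto
    then show "S \<in> {S \<in> matroid_bases indep. card (S \<inter> E1) = 3 \<and> card (S \<inter> E2) = 0 \<and> card (S \<inter> E3) = 0}"
      using card_base_split[OF S] S by (auto simp: bases_eq)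
  next
    fix S assume "S \<in> {S \<in> matroid_bases indep. card (S \<inter> E1) = 3 \<and> card (S \<inter> E2) = 0 \<and> card (S \<inter> E3) = 0}"
    then have S: "S \<in> matroid_bases indep" and "card (S \<inter> E1) = 3" by auto
    moreover from S have "card S = 3" "finite S" using finite_indep by (auto simp: bases_eq)
    ultimately have sub: "S \<subseteq> E1" using card_subset_eq[of S "S \<inter> E1"] by auto
    obtain x y z where "S = {x, y, z}" "x \<noteq> y" "x \<noteq> z" "y \<noteq> z"
      using \<open>card S = 3\<close> unfolding card_3_iff by auto
    then show "S \<in> underlying ` ?O"
      using S sub by (intro image_eqI[of _ _ "(x, y, z)"])
        (auto simp: ordered_bases_def underlying_def basis_triple_iff_base)
  qed
  have "card ?O = 6 * card (underlying ` ?O)"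
  proof (rule card_by_fibres[OF fin])
    fix S assume "S \<in> underlying ` ?O"
    then obtain x y z where xyz: "x \<in> E1" "y \<in> E1" "z \<in> E1" "basis_triple x y z" "S = {x, y, z}"
      by (auto simp: ordered_bases_def underlying_def)
    note d = basis_tripleD[OF xyz(4)]
    have "{s \<in> ?O. underlying s = S} = {(x,y,z), (x,z,y), (y,x,z), (y,z,x), (z,x,y), (z,y,x)}"
    proof (intro equalityI subsetI)
      fix s assume "s \<in> {s \<in> ?O. underlying s = S}"
      then obtain a b c where s: "s = (a, b, c)" "basis_triple a b c" "{a, b, c} = {x, y, z}"
        using xyz(5) by (auto simp: ordered_bases_def underlying_def)
      have "a \<in> {x, y, z}" "b \<in> {x, y, z}" "c \<in> {x, y, z}" using s(3) by blast+
      then show "s \<in> {(x,y,z), (x,z,y), (y,x,z), (y,z,x), (z,x,y), (z,y,x)}"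
        using basis_tripleD[OF s(2)] s(1) by auto
    next
      fix s assume "s \<in> {(x,y,z), (x,z,y), (y,x,z), (y,z,x), (z,x,y), (z,y,x)}"
      then show "s \<in> {s \<in> ?O. underlying s = S}"
        using xyz by (auto simp: ordered_bases_def underlying_def basis_triple_def insert_commute)
    qed
    then show "card {s \<in> ?O. underlying s = S} = 6" using d by auto
  qed
  then show ?thesis unfolding img base_count_def .
qed

lemma base_count_210: "card (ordered_bases E2 E1 E1) = 2 * base_count indep E1 E2 E3 2 1 0"
proof -
  let ?O = "ordered_bases E2 E1 E1"
  have disj: "E1 \<inter> E2 = {}" "E1 \<inter> E3 = {}" using col by (auto simp: three_coloring_def)
  have fin: "finite ?O" using finite_subset[OF ordered_bases_subset] finite_classes by blast
  have img: "underlying ` ?O = {S \<in> matroid_bases indep. card (S \<inter> E1) = 2 \<and> card (S \<inter> E2) = 1 \<and> card (S \<inter> E3) = 0}"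
  proof (intro equalityI subsetI)
    fix S assume "S \<in> underlying ` ?O"
    then obtain e x y where exy: "e \<in> E2" "x \<in> E1" "y \<in> E1" "basis_triple e x y" "S = {e, x, y}"
      by (auto simp: ordered_bases_def underlying_def)
    then have S: "S \<in> matroid_bases indep" using basis_triple_iff_base by simp
    have "S \<inter> E1 = {x, y}" "S \<inter> E2 = {e}" using exy disj by auto
    then have "card (S \<inter> E1) = 2" "card (S \<inter> E2) = 1" using basis_tripleD[OF exy(4)] by simp_all
    then show "S \<in> {S \<in> matroid_bases indep. card (S \<inter> E1) = 2 \<and> card (S \<inter> E2) = 1 \<and> card (S \<inter> E3) = 0}"
      using card_base_split[OF S] S by simp
  next
    fix S assume "S \<in> {S \<in> matroid_bases indep. card (S \<inter> E1) = 2 \<and> card (S \<inter> E2) = 1 \<and> card (S \<inter> E3) = 0}"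
    then have S: "S \<in> matroid_bases indep" and c: "card (S \<inter> E1) = 2" "card (S \<inter> E2) = 1" "card (S \<inter> E3) = 0"
      by auto
    obtain x y where xy: "S \<inter> E1 = {x, y}" "x \<noteq> y" using c(1) unfolding card_2_iff by blast
    obtain e where e: "S \<inter> E2 = {e}" using c(2) card_1_singletonE by blast
    have "finite S" using S finite_indep by (simp add: bases_eq)
    then have "S \<inter> E3 = {}" using c(3) by simp
    then have "S = {e} \<union> {x, y}"
      unfolding xy(1)[symmetric] e[symmetric] using base_subset[OF S] col by (auto simp: three_coloring_def)
    moreover have "e \<in> E2" "x \<in> E1" "y \<in> E1" using xy e by auto
    moreover from this have "e \<noteq> x" "e \<noteq> y" using disj by auto
    ultimately show "S \<in> underlying ` ?O"
      using S xy(2) by (intro image_eqI[of _ _ "(e, x, y)"])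
        (auto simp: ordered_bases_def underlying_def basis_triple_iff_base insert_commute)
  qed
  have "card ?O = 2 * card (underlying ` ?O)"
  proof (rule card_by_fibres[OF fin])
    fix S assume "S \<in> underlying ` ?O"
    then obtain e x y where exy: "e \<in> E2" "x \<in> E1" "y \<in> E1" "basis_triple e x y" "S = {e, x, y}"
      by (auto simp: ordered_bases_def underlying_def)
    note d = basis_tripleD[OF exy(4)]
    have "{s \<in> ?O. underlying s = S} = {(e,x,y), (e,y,x)}"
    proof (intro equalityI subsetI)
      fix s assume "s \<in> {s \<in> ?O. underlying s = S}"
      then obtain a b c where s: "s = (a, b, c)" "basis_triple a b c" "{a, b, c} = {e, x, y}"
          "a \<in> E2" "b \<in> E1" "c \<in> E1"
        using exy(5) by (auto simp: ordered_bases_def underlying_def)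
      have "a \<in> {e, x, y}" "b \<in> {e, x, y}" "c \<in> {e, x, y}" using s(3) by blast+
      then have "a = e" "b \<in> {x, y}" "c \<in> {x, y}" using s(4-6) exy(1-3) disj by auto
      then show "s \<in> {(e,x,y), (e,y,x)}"
        using basis_tripleD[OF s(2)] s(1) by auto
    next
      fix s assume "s \<in> {(e,x,y), (e,y,x)}"
      then show "s \<in> {s \<in> ?O. underlying s = S}"
        using exy by (auto simp: ordered_bases_def underlying_def basis_triple_def insert_commute)
    qed
    then show "card {s \<in> ?O. underlying s = S} = 2" using d by auto
  qed
  then show ?thesis unfolding img base_count_def .
qed

lemma base_count_111: "card (ordered_bases E2 E3 E1) = base_count indep E1 E2 E3 1 1 1"
proof -
  let ?O = "ordered_bases E2 E3 E1"
  have disj: "E1 \<inter> E2 = {}" "E1 \<inter> E3 = {}" "E2 \<inter> E3 = {}" using col by (auto simp: three_coloring_def)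
  have img: "underlying ` ?O = {S \<in> matroid_bases indep. card (S \<inter> E1) = 1 \<and> card (S \<inter> E2) = 1 \<and> card (S \<inter> E3) = 1}"
  proof (intro equalityI subsetI)
    fix S assume "S \<in> underlying ` ?O"
    then obtain e f x where efx: "e \<in> E2" "f \<in> E3" "x \<in> E1" "basis_triple e f x" "S = {e, f, x}"
      by (auto simp: ordered_bases_def underlying_def)
    then have S: "S \<in> matroid_bases indep" using basis_triple_iff_base by simp
    have "S \<inter> E1 = {x}" "S \<inter> E2 = {e}" "S \<inter> E3 = {f}" using efx disj by auto
    then show "S \<in> {S \<in> matroid_bases indep. card (S \<inter> E1) = 1 \<and> card (S \<inter> E2) = 1 \<and> card (S \<inter> E3) = 1}"
      using S by simp
  next
    fix S assume "S \<in> {S \<in> matroid_bases indep. card (S \<inter> E1) = 1 \<and> card (S \<inter> E2) = 1 \<and> card (S \<inter> E3) = 1}"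
    then have S: "S \<in> matroid_bases indep" and c: "card (S \<inter> E1) = 1" "card (S \<inter> E2) = 1" "card (S \<inter> E3) = 1"
      by auto
    obtain x e f where xef: "S \<inter> E1 = {x}" "S \<inter> E2 = {e}" "S \<inter> E3 = {f}"
      using c card_1_singletonE by metis
    have "S = {e} \<union> {f} \<union> {x}"
      unfolding xef[symmetric] using base_subset[OF S] col by (auto simp: three_coloring_def)
    moreover have "x \<in> E1" "e \<in> E2" "f \<in> E3" using xef by auto
    moreover from this have "e \<noteq> x" "f \<noteq> x" "e \<noteq> f" using disj by auto
    ultimately show "S \<in> underlying ` ?O"
      using S by (intro image_eqI[of _ _ "(e, f, x)"])
        (auto simp: ordered_bases_def underlying_def basis_triple_iff_base insert_commute)
  qed
  have "inj_on underlying ?O"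
  proof (rule inj_onI)
    fix s t assume s: "s \<in> ?O" and t: "t \<in> ?O" and eq: "underlying s = underlying t"
    obtain e f x where s': "s = (e, f, x)" "e \<in> E2" "f \<in> E3" "x \<in> E1"
      using s by (auto simp: ordered_bases_def)
    obtain a b c where t': "t = (a, b, c)" "a \<in> E2" "b \<in> E3" "c \<in> E1"
      using t by (auto simp: ordered_bases_def)
    have "e \<in> {a, b, c}" "f \<in> {a, b, c}" "x \<in> {a, b, c}"
      using eq s'(1) t'(1) by (auto simp: underlying_def)
    then show "s = t" using s' t' disj by auto
  qed
  from card_image[OF this] show ?thesis unfolding img base_count_def by simp
qed

end

lemma base_count_rotate: "base_count indep E1 E2 E3 a b c = base_count indep E2 E3 E1 b c a"
  unfolding base_count_def by (rule arg_cong[of _ _ card]) auto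

lemma base_count_swap: "base_count indep E1 E2 E3 a b c = base_count indep E1 E3 E2 a c b"
  unfolding base_count_def by (rule arg_cong[of _ _ card]) auto

lemma three_coloring_rotate: "three_coloring E E1 E2 E3 \<Longrightarrow> three_coloring E E2 E3 E1"
  unfolding three_coloring_def by auto

lemma three_coloring_swap: "three_coloring E E1 E2 E3 \<Longrightarrow> three_coloring E E1 E3 E2"
  unfolding three_coloring_def by auto

text \<open>Summing the Rayleigh inequality over \<open>e\<close> of the second and \<open>f\<close> of the third color factorises
  the right-hand side. Passing to unordered bases divides the left by 6 and the right by 4, which
  together with the factors 2 and 3 leaves the constant 1.\<close>

theorem correlation:
  assumes col: "three_coloring E E1 E2 E3"
  defines "b \<equiv> base_count indep E1 E2 E3"
  shows "b 1 1 1 * b 3 0 0 \<le> b 2 1 0 * b 2 0 1"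
proof -
  note fin = finite_classes[OF col]
  let ?t = "\<lambda>x y z. of_bool (basis_triple x y z) :: real"
  have b300: "6 * real (b 3 0 0) = (\<Sum>x\<in>E1. \<Sum>y\<in>E1. \<Sum>z\<in>E1. ?t x y z)"
    using base_count_300[OF col] card_ordered_bases[OF fin(1,1,1)] by (simp add: b_def)
  have b111: "real (b 1 1 1) = (\<Sum>e\<in>E2. \<Sum>f\<in>E3. \<Sum>x\<in>E1. ?t e f x)"
    using base_count_111[OF col] card_ordered_bases[OF fin(2,3,1)] by (simp add: b_def)
  have b210: "2 * real (b 2 1 0) = (\<Sum>e\<in>E2. \<Sum>x\<in>E1. \<Sum>y\<in>E1. ?t e x y)"
    using base_count_210[OF col] card_ordered_bases[OF fin(2,1,1)] by (simp add: b_def)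
  have b201: "2 * real (b 2 0 1) = (\<Sum>f\<in>E3. \<Sum>x\<in>E1. \<Sum>y\<in>E1. ?t f x y)"
    using base_count_210[OF three_coloring_swap[OF col]] card_ordered_bases[OF fin(3,1,1)]
    by (simp add: b_def base_count_swap[of E1 E2 E3])
  have "12 * (real (b 1 1 1) * real (b 3 0 0))
      = (\<Sum>e\<in>E2. \<Sum>f\<in>E3. 2 * (\<Sum>x\<in>E1. ?t e f x) * (\<Sum>x\<in>E1. \<Sum>y\<in>E1. \<Sum>z\<in>E1. ?t x y z))"
    unfolding b300[symmetric] b111 by (simp add: sum_distrib_left sum_distrib_right mult_ac)
  also have "\<dots> \<le> (\<Sum>e\<in>E2. \<Sum>f\<in>E3. 3 * (\<Sum>x\<in>E1. \<Sum>y\<in>E1. ?t e x y) * (\<Sum>x\<in>E1. \<Sum>y\<in>E1. ?t f x y))"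
    by (intro sum_mono rayleigh fin)
  also have "\<dots> = 3 * (2 * real (b 2 1 0)) * (2 * real (b 2 0 1))"
    unfolding b210 b201 mult.assoc sum_product by (simp only: sum_distrib_left)
  finally have "real (b 1 1 1 * b 3 0 0) \<le> real (b 2 1 0 * b 2 0 1)" by simp
  then show ?thesis by (simp only: of_nat_le_iff)
qed

text \<open>The three instances of the correlation inequality, one for each choice of the
  repeated color, involve each factor on the right exactly once.\<close>

theorem three_color_inequality:
  assumes col: "three_coloring E E1 E2 E3"
  defines "b \<equiv> base_count indep E1 E2 E3"
  shows "b 1 1 1 ^ 3 * b 3 0 0 * b 0 3 0 * b 0 0 3
    \<le> b 2 1 0 * b 2 0 1 * b 1 2 0 * b 0 2 1 * b 1 0 2 * b 0 1 2"
proof -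
  note col' = three_coloring_rotate[OF col]
  note col'' = three_coloring_rotate[OF col']
  have 1: "b 1 1 1 * b 3 0 0 \<le> b 2 1 0 * b 2 0 1"
    using correlation[OF col] by (simp add: b_def)
  have 2: "b 1 1 1 * b 0 3 0 \<le> b 0 2 1 * b 1 2 0"
    using correlation[OF col'] by (simp add: b_def base_count_rotate[of E1 E2 E3])
  have 3: "b 1 1 1 * b 0 0 3 \<le> b 1 0 2 * b 0 1 2"
    using correlation[OF col''] by (simp add: b_def base_count_rotate[of E3 E1 E2, symmetric])
  have "b 1 1 1 ^ 3 * b 3 0 0 * b 0 3 0 * b 0 0 3
      = (b 1 1 1 * b 3 0 0) * (b 1 1 1 * b 0 3 0) * (b 1 1 1 * b 0 0 3)"
    by (simp add: power3_eq_cube mult_ac)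
  also have "\<dots> \<le> (b 2 1 0 * b 2 0 1) * (b 0 2 1 * b 1 2 0) * (b 1 0 2 * b 0 1 2)"
    by (intro mult_mono 1 2 3) auto
  finally show ?thesis by (simp add: mult_ac)
qed

end

section \<open>Sharpness of the constant\<close>

lemma partition_matroid:
  assumes "finite E"
  shows "matroid E (\<lambda>X. X \<subseteq> E \<and> inj_on c X)"
proof
  fix X Y assume X: "X \<subseteq> E \<and> inj_on c X" and Y: "Y \<subseteq> E \<and> inj_on c Y" and lt: "card X < card Y"
  have "card (c ` X) < card (c ` Y)" using X Y lt by (simp add: card_image)
  moreover have "finite (c ` X)" using X assms finite_subset by blast
  ultimately have "\<not> c ` Y \<subseteq> c ` X" using card_mono leD by blast
  then obtain y where "y \<in> Y" "c y \<notin> c ` X" by blast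
  then show "\<exists>y\<in>Y - X. insert y X \<subseteq> E \<and> inj_on c (insert y X)"
    using X Y by (intro bexI[of _ y]) auto
qed (use assms in \<open>auto intro: inj_on_subset\<close>)

text \<open>Equality is approached by partition matroids on three parts whose part \<open>j\<close> contains \<open>n\<close>
  elements of color \<open>j\<close> and one of each other color. Their basis generating polynomial by
  colors is \<open>(n x + y + z) (x + n y + z) (x + y + n z)\<close>.\<close>

definition cell_size :: "nat \<Rightarrow> nat \<Rightarrow> nat \<Rightarrow> nat" where
  "cell_size n i j = (if i = j then n else 1)"

text \<open>The natural number \<open>9 k + 3 i + j\<close> encodes the \<open>k\<close>-th element of color \<open>i\<close> in part \<open>j\<close>.\<close>

definition part :: "nat \<Rightarrow> nat" where "part x = x mod 3"
definition color :: "nat \<Rightarrow> nat" where "color x = x div 3 mod 3"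

definition ground :: "nat \<Rightarrow> nat set" where
  "ground n = {x. x div 9 < cell_size n (color x) (part x)}"

definition color_class :: "nat \<Rightarrow> nat \<Rightarrow> nat set" where
  "color_class n i = {x \<in> ground n. color x = i}"

abbreviation transversal :: "nat \<Rightarrow> nat set \<Rightarrow> bool" where
  "transversal n X \<equiv> X \<subseteq> ground n \<and> inj_on part X"

lemma part_less: "part x < 3" and color_less: "color x < 3"
  by (simp_all add: part_def color_def)

lemma finite_ground: "finite (ground n)"
proof (rule finite_subset)
  show "ground n \<subseteq> {..<9 * (n + 1)}"
  proof
    fix x assume "x \<in> ground n"
    then have "x div 9 < n + 1" by (auto simp: ground_def cell_size_def split: if_splits)
    then show "x \<in> {..<9 * (n + 1)}" by (simp add: div_less_iff_less_mult mult.commute)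
  qed
qed simp

lemma card_cell:
  assumes "i < 3" "j < 3"
  shows "card {x \<in> ground n. part x = j \<and> color x = i} = cell_size n i j"
proof -
  have "{x \<in> ground n. part x = j \<and> color x = i} = (\<lambda>k. 9 * k + 3 * i + j) ` {..<cell_size n i j}"
  proof (intro equalityI subsetI)
    fix x assume "x \<in> {x \<in> ground n. part x = j \<and> color x = i}"
    then have "x div 9 < cell_size n i j" "x mod 3 = j" "x div 3 mod 3 = i"
      by (auto simp: ground_def part_def color_def)
    moreover have "x div 9 = x div 3 div 3" using div_mult2_eq[of x 3 3] by simp
    then have "x = 9 * (x div 9) + 3 * (x div 3 mod 3) + x mod 3"
      using div_mult_mod_eq[of x 3] div_mult_mod_eq[of "x div 3" 3] by linarith
    ultimately show "x \<in> (\<lambda>k. 9 * k + 3 * i + j) ` {..<cell_size n i j}"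
      by (intro image_eqI[of _ _ "x div 9"]) auto
  next
    fix x assume "x \<in> (\<lambda>k. 9 * k + 3 * i + j) ` {..<cell_size n i j}"
    then obtain k where k: "k < cell_size n i j" "x = 9 * k + 3 * i + j" by auto
    define q where "q = 3 * k + i"
    have "x = 3 * q + j" using k(2) by (simp add: q_def)
    then have "x mod 3 = j" "x div 3 = q" using assms(2) by simp_all
    moreover from this have "x div 3 mod 3 = i" "x div 9 = k"
      using assms(1) div_mult2_eq[of x 3 3] by (simp_all add: q_def)
    ultimately show "x \<in> {x \<in> ground n. part x = j \<and> color x = i}"
      using k(1) by (simp add: ground_def part_def color_def)
  qed
  moreover have "inj_on (\<lambda>k. 9 * k + 3 * i + j) {..<cell_size n i j}" by (auto intro: inj_onI)
  ultimately show ?thesis by (simp add: card_image)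
qed

lemma sum_over_part:
  fixes F :: "nat \<Rightarrow> nat"
  assumes "j < 3"
  shows "(\<Sum>x | x \<in> ground n \<and> part x = j. F (color x)) = (\<Sum>i<3. cell_size n i j * F i)"
proof -
  let ?D = "{x \<in> ground n. part x = j}"
  have "(\<Sum>x\<in>?D. F (color x)) = (\<Sum>i<3. \<Sum>x | x \<in> ?D \<and> color x = i. F (color x))"
    by (rule sum.group[symmetric]) (auto simp: finite_ground color_less)
  also have "\<dots> = (\<Sum>i<3. cell_size n i j * F i)"
    using assms by (intro sum.cong refl) (simp add: card_cell[symmetric] conj_assoc)
  finally show ?thesis by simp
qed

lemma ex_in_part:
  assumes "j < 3" "n \<ge> 1"
  shows "\<exists>x \<in> ground n. part x = j \<and> color x = j"
proof -
  have "card {x \<in> ground n. part x = j \<and> color x = j} \<noteq> 0"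
    using card_cell[OF assms(1,1), of n] assms(2) by (simp add: cell_size_def)
  then have "{x \<in> ground n. part x = j \<and> color x = j} \<noteq> {}" by (metis card.empty)
  then show ?thesis by blast
qed

lemma card_transversal_le: "transversal n X \<Longrightarrow> card X \<le> 3"
  using card_mono[of "{..<3}" "part ` X"] part_less by (auto simp: card_image)

lemma triple_transversal:
  assumes "x \<in> ground n" "y \<in> ground n" "z \<in> ground n" "part x = 0" "part y = 1" "part z = 2"
  shows "transversal n {x, y, z}" "card {x, y, z} = 3"
proof -
  have "x \<noteq> y" "x \<noteq> z" "y \<noteq> z" using assms by auto
  then show "transversal n {x, y, z}" "card {x, y, z} = 3" using assms by auto
qed

lemma rank_transversal:
  assumes "n \<ge> 1"
  shows "rank_three_matroid (ground n) (transversal n)"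
proof (intro rank_three_matroid.intro partition_matroid finite_ground rank_three_matroid_axioms.intro)
  obtain x y z where "x \<in> ground n" "part x = 0" "y \<in> ground n" "part y = 1" "z \<in> ground n" "part z = 2"
    using ex_in_part[of 0 n] ex_in_part[of 1 n] ex_in_part[of 2 n] assms by auto
  note t = triple_transversal[OF this(1,3,5,2,4,6)]
  have "finite {X. transversal n X}" by (rule finite_subset[of _ "Pow (ground n)"]) (auto simp: finite_ground)
  then show "matroid_rank (transversal n) = 3"
    unfolding matroid_rank_def using card_transversal_le t
    by (intro Max_eqI) (auto intro!: image_eqI[of _ _ "{x, y, z}"])
qed

lemma coloring: "three_coloring (ground n) (color_class n 0) (color_class n 1) (color_class n 2)"
proof -
  have "color x = 0 \<or> color x = 1 \<or> color x = 2" for x using color_less[of x] by linarith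
  then show ?thesis unfolding three_coloring_def color_class_def by auto
qed

text \<open>A basis picks one element from each part, and its color vector depends only on the colors
  \<open>i\<close>, \<open>j\<close>, \<open>k\<close> picked from parts 0, 1, 2; the formula collects the
  terms of the expanded product of three linear forms that belong to \<open>x\<^sup>a y\<^sup>b z\<^sup>c\<close>.\<close>

lemma base_count_transversal:
  assumes "n \<ge> 1"
  shows "base_count (transversal n) (color_class n 0) (color_class n 1) (color_class n 2) a b c
    = (\<Sum>i<3. cell_size n i 0 * (\<Sum>j<3. cell_size n j 1 * (\<Sum>k<3. cell_size n k 2 *
        of_bool (\<forall>l<3. of_bool (i = l) + of_bool (j = l) + of_bool (k = l) = [a, b, c] ! l))))"
proof -
  interpret rank_three_matroid "ground n" "transversal n" by (rule rank_transversal[OF assms])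
  define D where "D = (\<lambda>j. {x \<in> ground n. part x = j})"
  have finD: "finite (D j)" for j by (simp add: D_def finite_ground)
  define P where "P = (\<lambda>i j k. \<forall>l<3. of_bool (i = l) + of_bool (j = l) + of_bool (k = l) = [a, b, c] ! l)"
  define T where "T = {(x, y, z). x \<in> D 0 \<and> y \<in> D 1 \<and> z \<in> D 2 \<and> P (color x) (color y) (color z)}"
  let ?h = "\<lambda>(x, y, z). {x, y, z}"
  have P: "P (color x) (color y) (color z) \<longleftrightarrow> card ({x, y, z} \<inter> color_class n 0) = a
      \<and> card ({x, y, z} \<inter> color_class n 1) = b \<and> card ({x, y, z} \<inter> color_class n 2) = c"
    if "x \<in> D 0" "y \<in> D 1" "z \<in> D 2" for x y z
  proof -
    have "card ({x, y, z} \<inter> color_class n l) = of_bool (color x = l) + of_bool (color y = l) + of_bool (color z = l)" for l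
    proof -
      have "x \<noteq> y" "x \<noteq> z" "y \<noteq> z" using that by (auto simp: D_def)
      then show ?thesis using that by (auto simp: D_def color_class_def Int_insert_left)
    qed
    then show ?thesis by (simp add: P_def All_less_Suc numeral_3_eq_3 numeral_2_eq_2) blast
  qed
  have img: "?h ` T = {S \<in> matroid_bases (transversal n). card (S \<inter> color_class n 0) = a
      \<and> card (S \<inter> color_class n 1) = b \<and> card (S \<inter> color_class n 2) = c}"
  proof (intro equalityI subsetI)
    fix S assume "S \<in> ?h ` T"
    then obtain x y z where xyz: "x \<in> D 0" "y \<in> D 1" "z \<in> D 2" "P (color x) (color y) (color z)" "S = {x, y, z}"
      by (auto simp: T_def)
    have "transversal n S" "card S = 3"
      using triple_transversal[of x n y z] xyz(1-3,5) by (simp_all add: D_def)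
    then show "S \<in> {S \<in> matroid_bases (transversal n). card (S \<inter> color_class n 0) = a
      \<and> card (S \<inter> color_class n 1) = b \<and> card (S \<inter> color_class n 2) = c}"
      using P[OF xyz(1-3)] xyz(4,5) by (simp add: bases_eq)
  next
    fix S assume S: "S \<in> {S \<in> matroid_bases (transversal n). card (S \<inter> color_class n 0) = a
      \<and> card (S \<inter> color_class n 1) = b \<and> card (S \<inter> color_class n 2) = c}"
    then have "transversal n S" "card S = 3" by (auto simp: bases_eq)
    then have "card (part ` S) = 3" "part ` S \<subseteq> {..<3}" using part_less by (auto simp: card_image)
    then have "part ` S = {..<3}" by (intro card_subset_eq) auto
    then have "0 \<in> part ` S" "1 \<in> part ` S" "2 \<in> part ` S" by auto
    then obtain x y z where xyz: "x \<in> S" "part x = 0" "y \<in> S" "part y = 1" "z \<in> S" "part z = 2" by force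
    have "finite S" using \<open>card S = 3\<close> card.infinite by fastforce
    have D: "x \<in> D 0" "y \<in> D 1" "z \<in> D 2"
      using xyz \<open>transversal n S\<close> by (auto simp: D_def)
    have "card {x, y, z} = 3"
      using D triple_transversal[of x n y z] by (simp add: D_def)
    then have "S = {x, y, z}"
      using card_subset_eq[OF \<open>finite S\<close>, of "{x, y, z}"] xyz \<open>card S = 3\<close> by auto
    then show "S \<in> ?h ` T"
      using S D P[OF D] by (intro image_eqI[of _ _ "(x, y, z)"]) (auto simp: T_def)
  qed
  have inj: "inj_on ?h T"
  proof (rule inj_onI)
    fix s t assume s: "s \<in> T" and t: "t \<in> T" and eq: "?h s = ?h t"
    obtain x y z where s': "s = (x, y, z)" "x \<in> D 0" "y \<in> D 1" "z \<in> D 2"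
      using s by (auto simp: T_def)
    obtain u v w where t': "t = (u, v, w)" "u \<in> D 0" "v \<in> D 1" "w \<in> D 2"
      using t by (auto simp: T_def)
    have "x \<in> {u, v, w}" "y \<in> {u, v, w}" "z \<in> {u, v, w}" using eq s'(1) t'(1) by auto
    then show "s = t" using s' t' by (auto simp: D_def)
  qed
  have "base_count (transversal n) (color_class n 0) (color_class n 1) (color_class n 2) a b c = card T"
    unfolding base_count_def img[symmetric] by (rule card_image[OF inj])
  also have "\<dots> = (\<Sum>t\<in>D 0 \<times> D 1 \<times> D 2. of_bool (t \<in> T))"
    using finD by (simp add: T_def Int_def) (rule arg_cong[of _ _ card], auto)
  also have "\<dots> = (\<Sum>x\<in>D 0. \<Sum>y\<in>D 1. \<Sum>z\<in>D 2. of_bool (P (color x) (color y) (color z)))"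
    unfolding sum.cartesian_product by (intro sum.cong refl) (auto simp: T_def)
  also have "\<dots> = (\<Sum>i<3. cell_size n i 0 * (\<Sum>j<3. cell_size n j 1 * (\<Sum>k<3. cell_size n k 2 * of_bool (P i j k))))"
  proof -
    have part_sum: "(\<Sum>x\<in>D j. F (color x)) = (\<Sum>i<3. cell_size n i j * F i)" if "j < 3" for j and F :: "nat \<Rightarrow> nat"
      unfolding D_def by (rule sum_over_part[OF that])
    have "(\<Sum>z\<in>D 2. of_bool (P u v (color z))) = (\<Sum>k<3. cell_size n k 2 * of_bool (P u v k))" for u v
      by (rule part_sum) simp
    moreover have "(\<Sum>y\<in>D 1. \<Sum>k<3. cell_size n k 2 * of_bool (P u (color y) k))
        = (\<Sum>j<3. cell_size n j 1 * (\<Sum>k<3. cell_size n k 2 * of_bool (P u j k)))" for u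
      by (rule part_sum) simp
    moreover have "(\<Sum>x\<in>D 0. \<Sum>j<3. cell_size n j 1 * (\<Sum>k<3. cell_size n k 2 * of_bool (P (color x) j k)))
        = (\<Sum>i<3. cell_size n i 0 * (\<Sum>j<3. cell_size n j 1 * (\<Sum>k<3. cell_size n k 2 * of_bool (P i j k))))"
      by (rule part_sum) simp
    ultimately show ?thesis by (simp only:)
  qed
  finally show ?thesis unfolding P_def .
qed

lemma base_counts_transversal:
  assumes "n \<ge> 1"
  defines "b \<equiv> base_count (transversal n) (color_class n 0) (color_class n 1) (color_class n 2)"
  shows "b 1 1 1 = n ^ 3 + 3 * n + 2"
    and "b 3 0 0 = n" "b 0 3 0 = n" "b 0 0 3 = n"
    and "b 2 1 0 = n\<^sup>2 + n + 1" "b 2 0 1 = n\<^sup>2 + n + 1" "b 1 2 0 = n\<^sup>2 + n + 1"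
    and "b 0 2 1 = n\<^sup>2 + n + 1" "b 1 0 2 = n\<^sup>2 + n + 1" "b 0 1 2 = n\<^sup>2 + n + 1"
  unfolding b_def base_count_transversal[OF assms(1)]
  by (simp_all add: cell_size_def numeral_3_eq_3 numeral_2_eq_2 All_less_Suc algebra_simps)

text \<open>For the partition matroids above both sides grow like \<open>n\<close> to the power 12 with leading
  coefficient 1, so the ratio of the two sides tends to 1.\<close>

theorem constant_sharp:
  fixes C :: real
  assumes "\<And>E indep E1 E2 E3. matroid (E :: nat set) indep \<Longrightarrow> matroid_rank indep = 3 \<Longrightarrow>
    three_coloring E E1 E2 E3 \<Longrightarrow>
    (let b = (\<lambda>i j k. real (base_count indep E1 E2 E3 i j k)) in
      b 1 1 1 ^ 3 * b 3 0 0 * b 0 3 0 * b 0 0 3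
        \<le> C * (b 2 1 0 * b 2 0 1 * b 1 2 0 * b 0 2 1 * b 1 0 2 * b 0 1 2))"
  shows "1 \<le> C"
proof (rule LIMSEQ_le_const2)
  let ?f = "\<lambda>n. (real n ^ 3 + 3 * real n + 2) ^ 3 * real n ^ 3 / (real n ^ 2 + real n + 1) ^ 6"
  show "?f \<longlonglongrightarrow> 1" by real_asymp
  show "\<exists>N. \<forall>n\<ge>N. ?f n \<le> C"
  proof (intro exI allI impI)
    fix n :: nat assume n: "1 \<le> n"
    interpret rank_three_matroid "ground n" "transversal n" by (rule rank_transversal[OF n])
    have "(real n ^ 3 + 3 * real n + 2) ^ 3 * real n ^ 3 \<le> C * (real n ^ 2 + real n + 1) ^ 6"
      using assms[OF matroid_axioms rank coloring]
      unfolding base_counts_transversal[OF n] Let_def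
      by (simp add: power_numeral_reduce mult_ac add_ac)
    moreover have "0 < (real n ^ 2 + real n + 1) ^ 6" by (intro zero_less_power add_nonneg_pos) simp_all
    ultimately show "?f n \<le> C" by (simp add: pos_divide_le_eq)
  qed
qed

section \<open>The inequality with its optimal constant\<close>

theorem proposition7p3:
  "(\<forall>(E :: 'a set) indep E1 E2 E3.
      matroid E indep \<longrightarrow> matroid_rank indep = 3 \<longrightarrow> three_coloring E E1 E2 E3 \<longrightarrow>
      (let b = base_count indep E1 E2 E3 in
        b 1 1 1 ^ 3 * b 3 0 0 * b 0 3 0 * b 0 0 3
          \<le> b 2 1 0 * b 2 0 1 * b 1 2 0 * b 0 2 1 * b 1 0 2 * b 0 1 2))
   \<and> \<not> (\<exists>C :: real. C < 1 \<and>
      (\<forall>(E :: nat set) indep E1 E2 E3.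
        matroid E indep \<longrightarrow> matroid_rank indep = 3 \<longrightarrow> three_coloring E E1 E2 E3 \<longrightarrow>
        (let b = (\<lambda>i j k. real (base_count indep E1 E2 E3 i j k)) in
          b 1 1 1 ^ 3 * b 3 0 0 * b 0 3 0 * b 0 0 3
            \<le> C * (b 2 1 0 * b 2 0 1 * b 1 2 0 * b 0 2 1 * b 1 0 2 * b 0 1 2))))"
proof (intro conjI allI impI)
  fix E :: "'a set" and indep E1 E2 E3
  assume M: "matroid E indep" "matroid_rank indep = 3" and col: "three_coloring E E1 E2 E3"
  interpret rank_three_matroid E indep
    using M by (intro rank_three_matroid.intro rank_three_matroid_axioms.intro)
  show "let b = base_count indep E1 E2 E3 in
      b 1 1 1 ^ 3 * b 3 0 0 * b 0 3 0 * b 0 0 3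
        \<le> b 2 1 0 * b 2 0 1 * b 1 2 0 * b 0 2 1 * b 1 0 2 * b 0 1 2"
    unfolding Let_def by (rule three_color_inequality[OF col])
qed (use constant_sharp in \<open>meson not_le\<close>)

end
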